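(* Let $k \ge 2$ be an integer and let $\boldsymbol{\alpha} = (\alpha_1, \ldots, \alpha_{k-1}) \in \mathbb{R}^{k-1}$ satisfy $\omega^\times(\boldsymbol{\alpha}) < \frac{k-1}{k-2}$ (for $k=2$ this condition reads $\omega^\times(\boldsymbol{\alpha}) < \infty$). Then there exists $\varepsilon_0 > 0$, depending only on $\boldsymbol{\alpha}$, such that for every $\varepsilon \in (0, \varepsilon_0]$, with $\tau = \sqrt{\varepsilon}$, there exist $N_0 \in \mathbb{N}$ and $C > 0$, depending only on $\boldsymbol{\alpha}$ and $\varepsilon$, with the following property. Let $N \ge N_0$ be an integer, and let $\boldsymbol{\delta} = (\delta_1, \ldots, \delta_{k-1})$ be real numbers with \[ N^{-\tau} \le \delta_i \le 2 \qquad (1 \le i \le k-1). \] Then there exist $A_1, \ldots, A_k, N_1, \ldots, N_k \in \mathbb{N}$ such that the generalised arithmetic progression \[ P' = P(0; A_1, \ldots, A_k; N_1, \ldots, N_k) \] contains the homogeneous Bohr set $B_{\boldsymbol{\alpha}}^{\mathbf{0}}(N; \boldsymbol{\delta})$ and satisfies \[ |P'| \le C\, \delta_1 \cdots \delta_{k-1} N. \]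
   Context: $\mathbb{N}$ denotes the positive integers. For $x \in \mathbb{R}$, $\|x\|$ denotes the distance from $x$ to the nearest integer. The multiplicative exponent $\omega^\times(\boldsymbol{\alpha})$ is the supremum (possibly $+\infty$) of the set of real numbers $w$ such that, for infinitely many $n \in \mathbb{N}$, $\| n \alpha_1 \| \cdots \| n \alpha_{k-1} \| < n^{-w}$. The homogeneous Bohr set is \[ B_{\boldsymbol{\alpha}}^{\mathbf{0}}(N; \boldsymbol{\delta}) = \{ n \in \mathbb{Z} : |n| \le N, \ \| n \alpha_i \| \le \delta_i \ (1 \le i \le k-1) \}. \] For an integer $b \ge 0$ and $A_1, \ldots, A_k, N_1, \ldots, N_k \in \mathbb{N}$ define \[ P(b; A_1, \ldots, A_k; N_1, \ldots, N_k) = \{ b + A_1 n_1 + \cdots + A_k n_k : n_i \in \mathbb{Z},\ |n_i| \le N_i \ (1 \le i \le k)\}. \] *)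

theory Defs
  imports "HOL-Analysis.Analysis"
begin

text \<open>
  Tuples with entries indexed by \<open>1, \<dots>, m\<close> are functions on \<^typ>\<open>nat\<close> of which only the values at
  \<open>1, \<dots>, m\<close> are used; the length is passed as an explicit argument where it is needed.
\<close>

definition dist_nearest_int :: "real \<Rightarrow> real" where
  "dist_nearest_int x = \<bar>x - of_int (round x)\<bar>"

text \<open>
  Below, \<open>k\<close> is the rank of the progressions, so that \<open>\<alpha>\<close> and \<open>\<delta>\<close> have \<open>k - 1\<close> entries.
  The supremum is taken in \<^typ>\<open>ereal\<close>, so it is \<open>\<infinity>\<close> when the exponents are unbounded.
  The set of exponents always contains \<open>0\<close> if \<open>k \<ge> 2\<close>.
\<close>

definition mult_exponent :: "nat \<Rightarrow> (nat \<Rightarrow> real) \<Rightarrow> ereal" where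
  "mult_exponent k \<alpha> =
     Sup (ereal ` {w. infinite {n::nat. n \<ge> 1 \<and>
       (\<Prod>i=1..k-1. dist_nearest_int (real n * \<alpha> i)) < real n powr (- w)}})"

definition bohr_set0 :: "nat \<Rightarrow> (nat \<Rightarrow> real) \<Rightarrow> nat \<Rightarrow> (nat \<Rightarrow> real) \<Rightarrow> int set" where
  "bohr_set0 k \<alpha> N \<delta> =
     {n. \<bar>n\<bar> \<le> int N \<and> (\<forall>i\<in>{1..k-1}. dist_nearest_int (of_int n * \<alpha> i) \<le> \<delta> i)}"

definition gap :: "nat \<Rightarrow> nat \<Rightarrow> (nat \<Rightarrow> nat) \<Rightarrow> (nat \<Rightarrow> nat) \<Rightarrow> int set" where
  "gap k b A L =
     {int b + (\<Sum>i=1..k. int (A i) * n i) |n :: nat \<Rightarrow> int. \<forall>i\<in>{1..k}. \<bar>n i\<bar> \<le> int (L i)}"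

text \<open>By finiteness, \<^const>\<open>card\<close> of a progression is its genuine cardinality.\<close>

lemma finite_gap: "finite (gap k b A L)"
proof (rule finite_subset)
  let ?M = "int b + (\<Sum>i=1..k. int (A i) * int (L i))"
  show "gap k b A L \<subseteq> {- ?M .. ?M}"
  proof
    fix x assume "x \<in> gap k b A L"
    then obtain n where x: "x = int b + (\<Sum>i=1..k. int (A i) * n i)"
      and n: "\<forall>i\<in>{1..k}. \<bar>n i\<bar> \<le> int (L i)"
      unfolding gap_def by blast
    have "\<bar>\<Sum>i=1..k. int (A i) * n i\<bar> \<le> (\<Sum>i=1..k. \<bar>int (A i) * n i\<bar>)"
      by (rule sum_abs)
    also have "\<dots> \<le> (\<Sum>i=1..k. int (A i) * int (L i))"
      using n by (intro sum_mono) (simp add: abs_mult mult_left_mono)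
    finally show "x \<in> {- ?M .. ?M}"
      unfolding x by auto
  qed
qed simp

end

theory Submission
  imports Defs "HOL-Library.Function_Algebras"
begin

text \<open>
  An element \<open>n\<close> of the Bohr set is the first coordinate of a lattice point \<open>(n, m\<^sub>1, \<dots>, m\<^sub>k\<^sub>-\<^sub>1)\<close> with
  \<open>\<bar>n\<bar> \<le> N\<close> and \<open>\<bar>m\<^sub>i - n \<alpha>\<^sub>i\<bar> \<le> \<delta>\<^sub>i\<close>, hence of a point at which the quadratic form
  \<open>(n/N)\<^sup>2 + \<Sum>((m\<^sub>i - n \<alpha>\<^sub>i)/\<delta>\<^sub>i)\<^sup>2\<close> is at most \<open>k\<close>. This form has discriminant
  \<open>1 / (N \<delta>\<^sub>1 \<cdots> \<delta>\<^sub>k\<^sub>-\<^sub>1)\<^sup>2\<close>. In a reduced basis of the lattice, with squared orthogonalised lengths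
  \<open>d\<^sub>1, \<dots>, d\<^sub>k\<close>, the points in question have coefficients of size \<open>O(d\<^sub>i powr (-1/2))\<close>
  (\<open>reduced_coefficients\<close>). The first coordinates of the basis vectors are therefore the steps of a
  progression that contains the Bohr set. If every \<open>d\<^sub>i\<close> is at most \<open>1\<close>, then all lengths are \<open>\<ge> 1\<close>
  before rounding and the size of the progression is
  \<open>O((d\<^sub>1 \<cdots> d\<^sub>k) powr (-1/2)) = O(N \<delta>\<^sub>1 \<cdots> \<delta>\<^sub>k\<^sub>-\<^sub>1)\<close>, as desired (\<open>progression_cover\<close>).

  A large \<open>d\<^sub>i\<close> would mean that the lattice is concentrated near a subspace. Since
  \<open>d\<^sub>1 \<cdots> d\<^sub>k\<close> is known and all \<open>d\<^sub>i\<close> are bounded below in terms of \<open>d\<^sub>1\<close>, this is excluded once the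
  shortest vector is not too short (\<open>reduced_weights_le_1\<close>). A very short vector would give an \<open>n\<close> with
  \<open>\<parallel>n \<alpha>\<^sub>1\<parallel> \<cdots> \<parallel>n \<alpha>\<^sub>k\<^sub>-\<^sub>1\<parallel>\<close> too small for the multiplicative exponent, and the threshold
  \<open>(k-1)/(k-2)\<close> is where the two estimates meet (\<open>bohr_lattice_minimum\<close>).

  Lattice reduction is done without determinants or volumes. A quadratic form is kept as a
  sum of weighted squares of linear forms that are triangular with respect to a basis; basis changes
  act on two neighbouring vectors at a time, and the product of the weights is visibly conserved.
  This serves in place of Minkowski's second theorem, and it provides a basis at once, so that no
  passage from independent short vectors to a basis is necessary.
\<close>

section \<open>Cardinality of progressions\<close>

text \<open>
  Only the number of coefficient vectors is counted. In particular a step \<open>A i\<close> may be replaced by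
  any other without affecting the bound.
\<close>

lemma card_gap_le: "card (gap k b A L) \<le> (\<Prod>i=1..k. 2 * L i + 1)"
proof -
  define F where "F n = int b + (\<Sum>i=1..k. int (A i) * n i)" for n :: "nat \<Rightarrow> int"
  let ?E = "PiE {1..k} (\<lambda>i. {- int (L i) .. int (L i)})"
  have "gap k b A L \<subseteq> F ` ?E"
  proof
    fix x assume "x \<in> gap k b A L"
    then obtain n where n: "x = F n" "\<forall>i\<in>{1..k}. \<bar>n i\<bar> \<le> int (L i)" unfolding gap_def F_def by blast
    have "x = F (restrict n {1..k})" using n(1) unfolding F_def by simp
    moreover have "restrict n {1..k} \<in> ?E" using n(2) by (auto simp: abs_le_iff)
    ultimately show "x \<in> F ` ?E" by blast
  qed
  moreover have "finite ?E" by (intro finite_PiE) auto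
  ultimately have "card (gap k b A L) \<le> card ?E"
    using surj_card_le by blast
  also have "\<dots> = (\<Prod>i=1..k. 2 * L i + 1)" by (subst card_PiE) (auto intro!: prod.cong)
  finally show ?thesis .
qed

section \<open>Quadratic forms in triangular shape\<close>

text \<open>
  An entry \<open>(b, d, f)\<close> consists of a basis vector, a positive weight and the linear form that is the
  coordinate belonging to \<open>b\<close> in the orthogonal frame. Lattices are \<open>\<int>\<close>-modules with an abstract carrier
  type, so that the rank can vary in inductions.
\<close>

type_synonym 'a gs_system = "('a \<times> real \<times> ('a \<Rightarrow> real)) list"

locale int_module = module scale
  for scale :: "int \<Rightarrow> 'a::ab_group_add \<Rightarrow> 'a" (infixr "\<odot>" 75)
begin

definition linear_form :: "('a \<Rightarrow> real) \<Rightarrow> bool" where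
  "linear_form f \<longleftrightarrow> (\<forall>x y. f (x + y) = f x + f y) \<and> (\<forall>c x. f (c \<odot> x) = of_int c * f x)"

text \<open>
  Condition \<open>f' b = 0\<close> says that in the basis \<open>b\<^sub>1, \<dots>, b\<^sub>k\<close> the forms have an upper triangular matrix
  with unit diagonal: \<open>f\<^sub>i (b\<^sub>j) = 0\<close> for \<open>j < i\<close>. If the weights and forms come from the
  Gram--Schmidt process, then \<open>d\<^sub>i\<close> is the squared length of the \<open>i\<close>-th orthogonalised vector and
  the numbers \<open>f\<^sub>i (b\<^sub>j)\<close> for \<open>i < j\<close> are the Gram--Schmidt coefficients.
\<close>

fun triangular :: "'a gs_system \<Rightarrow> bool" where
  "triangular [] \<longleftrightarrow> True"
| "triangular ((b, d, f) # S) \<longleftrightarrow>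
     0 < d \<and> linear_form f \<and> f b = 1 \<and> (\<forall>(b', d', f') \<in> set S. f' b = 0) \<and> triangular S"

fun lattice :: "'a gs_system \<Rightarrow> 'a set" where
  "lattice [] = {0}"
| "lattice ((b, d, f) # S) = {c \<odot> b + y | c y. y \<in> lattice S}"

definition form :: "'a gs_system \<Rightarrow> 'a \<Rightarrow> real" where
  "form S x = (\<Sum>(b, d, f)\<leftarrow>S. d * (f x)\<^sup>2)"

text \<open>
  The Gram determinant of the form, because the change to triangular coordinates is unimodular.
\<close>

definition disc :: "'a gs_system \<Rightarrow> real" where
  "disc S = (\<Prod>(b, d, f)\<leftarrow>S. d)"

definition rebased :: "'a gs_system \<Rightarrow> 'a gs_system \<Rightarrow> bool" where
  "rebased S S' \<longleftrightarrow> triangular S' \<and> length S' = length S \<and> lattice S' = lattice S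
     \<and> form S' = form S \<and> disc S' = disc S"

text \<open>
  The second inequality is a weak form of the usual condition that consecutive weights decrease by
  a bounded factor only; it is what the estimates below consume, and the exponent is chosen so that
  it follows by induction along the list.
\<close>

fun reduced :: "'a gs_system \<Rightarrow> bool" where
  "reduced [] \<longleftrightarrow> True"
| "reduced ((b, d, f) # S) \<longleftrightarrow>
     (\<forall>(b', d', f') \<in> set S. \<bar>f b'\<bar> \<le> 1/2 \<and> d \<le> 2 ^ length S * d') \<and> reduced S"

lemma form_simps [simp]:
  "form [] x = 0"
  "form ((b, d, f) # S) x = d * (f x)\<^sup>2 + form S x"
  by (simp_all add: form_def)

lemma disc_simps [simp]:
  "disc [] = 1"
  "disc ((b, d, f) # S) = d * disc S"
  by (simp_all add: disc_def)

lemma linear_formD: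
  assumes "linear_form f"
  shows "f (x + y) = f x + f y" "f (c \<odot> x) = of_int c * f x" "f (x - y) = f x - f y" "f 0 = 0"
proof -
  show 1: "f (x + y) = f x + f y" for x y using assms by (simp add: linear_form_def)
  show "f (c \<odot> x) = of_int c * f x" using assms by (simp add: linear_form_def)
  show "f (x - y) = f x - f y" using 1[of "x - y" y] by simp
  show "f 0 = 0" using 1[of 0 0] by simp
qed

lemma triangular_memD:
  "triangular S \<Longrightarrow> (b, d, f) \<in> set S \<Longrightarrow> 0 < d \<and> linear_form f"
  by (induction S rule: triangular.induct) auto

lemma form_nonneg: "triangular S \<Longrightarrow> 0 \<le> form S x"
  by (induction S rule: triangular.induct) auto

lemma form_tail_cong:
  assumes "\<forall>(b', d', f') \<in> set S. f' b = 0" "triangular S"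
  shows "form S (c \<odot> b + y) = form S y"
  using assms by (induction S rule: triangular.induct) (auto simp: linear_formD)

text \<open>
  This recovers the triangular shape after the tail of a system has been replaced: the vector in
  front of the tail is a null vector of the tail's form, and that form does not change.
\<close>

lemma form_zero_imp:
  assumes "triangular S" "form S b = 0"
  shows "\<forall>(b', d', f') \<in> set S. f' b = 0"
  using assms
proof (induction S rule: triangular.induct)
  case (2 b' d f S)
  then show ?case using form_nonneg[of S b]
    by (auto simp: add_nonneg_eq_0_iff)
qed simp

lemma form_eq_zero: "\<forall>(b', d', f') \<in> set S. f' b = 0 \<Longrightarrow> form S b = 0"
  by (induction S rule: lattice.induct) auto

lemma lattice_zero: "0 \<in> lattice S"
proof (induction S rule: lattice.induct)
  case (2 b d f S)
  have "0 = 0 \<odot> b + 0" by simp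
  with 2 show ?case by (auto intro!: exI[of _ 0])
qed simp

lemma lattice_head: "b \<in> lattice ((b, d, f) # S)"
proof -
  have "b = 1 \<odot> b + 0" by simp
  then show ?thesis using lattice_zero[of S] unfolding lattice.simps by blast
qed

text \<open>
  A nonzero lattice point has a last nonzero coordinate \<open>c\<^sub>i\<close>, and then \<open>f\<^sub>i\<close> takes the integer
  value \<open>c\<^sub>i\<close>. So the least weight is a lower bound.
\<close>

lemma form_positive_minimum:
  assumes "triangular S"
  shows "\<exists>m>0. \<forall>x \<in> lattice S. x \<noteq> 0 \<longrightarrow> m \<le> form S x"
  using assms
proof (induction S rule: triangular.induct)
  case (2 b d f S)
  then obtain m where m: "m > 0" "\<And>x. x \<in> lattice S \<Longrightarrow> x \<noteq> 0 \<Longrightarrow> m \<le> form S x"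
    by auto
  have "min d m \<le> form ((b, d, f) # S) x" if x: "x \<in> lattice ((b, d, f) # S)" "x \<noteq> 0" for x
  proof -
    from x obtain c y where xy: "x = c \<odot> b + y" "y \<in> lattice S" by auto
    have t: "form S x = form S y" using 2(2) xy(1) form_tail_cong[of S b c y] by simp
    have d: "0 < d" using 2(2) by simp
    show ?thesis
    proof (cases "y = 0")
      case False
      have "0 \<le> d * (f x)\<^sup>2" using d by simp
      then show ?thesis using m(2)[OF xy(2) False] t by simp
    next
      case True
      with x(2) xy(1) have "c \<noteq> 0" by auto
      then have "1 \<le> c\<^sup>2" by (simp add: int_one_le_iff_zero_less)
      then have c: "1 \<le> (real_of_int c)\<^sup>2" by (metis of_int_1_le_iff of_int_power)
      have "f x = of_int c" using True xy(1) 2(2) by (simp add: linear_formD)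
      then have "d * 1 \<le> d * (f x)\<^sup>2" using c d by (intro mult_left_mono) auto
      moreover have "0 \<le> form S x" using form_nonneg[of S x] 2(2) by simp
      ultimately have "d \<le> form ((b, d, f) # S) x" unfolding form_simps by linarith
      then show ?thesis by (simp only: min.coboundedI1)
    qed
  qed
  then show ?case using 2(2) m(1) by (intro exI[of _ "min d m"]) auto
qed (auto intro: exI[of _ 1])

lemma rebased_refl: "triangular S \<Longrightarrow> rebased S S"
  by (simp add: rebased_def)

lemma rebased_trans: "rebased S T \<Longrightarrow> rebased T U \<Longrightarrow> rebased S U"
  by (simp add: rebased_def)

lemma rebased_head:
  assumes "rebased S ((b, d, f) # T)"
  shows "b \<in> lattice S" "b \<noteq> 0" "form S b = d"
proof -
  note * = assms[unfolded rebased_def]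
  then have tri: "triangular ((b, d, f) # T)" by simp
  show "b \<in> lattice S" using lattice_head[of b d f T] * by (simp del: lattice.simps)
  have 1: "f b = 1" "linear_form f" using * by auto
  then show "b \<noteq> 0" using linear_formD(4)[of f] by auto
  have "form ((b, d, f) # T) b = d"
    using 1 form_eq_zero[of T b] tri by simp
  moreover have "form S = form ((b, d, f) # T)" using * by simp
  ultimately show "form S b = d" by (simp only:)
qed

lemma rebased_Cons:
  assumes "triangular ((b, d, f) # S)" "rebased S S'"
  shows "rebased ((b, d, f) # S) ((b, d, f) # S')"
proof -
  note * = assms(2)[unfolded rebased_def]
  have "form S b = 0" using assms(1) form_eq_zero[of S b] by simp
  then have "\<forall>(b', d', f') \<in> set S'. f' b = 0"
    using form_zero_imp[of S' b] * by simp
  then show ?thesis using assms(1) * by (auto simp: rebased_def fun_eq_iff)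
qed

section \<open>Lattice reduction\<close>

text \<open>
  Subtracting integer multiples of the head \<open>b\<close> from the later vectors brings their coefficients
  along \<open>b\<close> into \<open>[-1/2, 1/2]\<close> and leaves all weights and forms as they are.
\<close>

definition size_reduce :: "'a \<Rightarrow> ('a \<Rightarrow> real) \<Rightarrow> 'a gs_system \<Rightarrow> 'a gs_system" where
  "size_reduce b f S = map (\<lambda>(b', d', f'). (b' - round (f b') \<odot> b, d', f')) S"

lemma size_reduce_simps [simp]:
  "size_reduce b f [] = []"
  "size_reduce b f ((b', d', f') # S) = (b' - round (f b') \<odot> b, d', f') # size_reduce b f S"
  "length (size_reduce b f S) = length S"
  by (simp_all add: size_reduce_def)

lemma size_reduce_mem:
  "(b'', d'', f'') \<in> set (size_reduce b f S) \<Longrightarrow> \<exists>b'. (b', d'', f'') \<in> set S \<and> b'' = b' - round (f b') \<odot> b"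
  by (auto simp: size_reduce_def)

lemma lattice_size_reduce:
  "{c \<odot> b + y | c y. y \<in> lattice (size_reduce b f S)} = {c \<odot> b + y | c y. y \<in> lattice S}"
proof (induction S rule: lattice.induct)
  case (2 b' d' f' S)
  let ?q = "round (f b')"
  let ?L = "{c \<odot> b + y | c y. y \<in> lattice S}" and ?L' = "{c \<odot> b + y | c y. y \<in> lattice (size_reduce b f S)}"
  show ?case (is "?A = ?B")
  proof (intro set_eqI iffI)
    fix x assume "x \<in> ?A"
    then obtain c e y where x: "x = c \<odot> b + (e \<odot> (b' - ?q \<odot> b) + y)" "y \<in> lattice (size_reduce b f S)" by auto
    have "(c - e * ?q) \<odot> b + y \<in> ?L'" using x by blast
    then obtain c' y' where y': "(c - e * ?q) \<odot> b + y = c' \<odot> b + y'" "y' \<in> lattice S" using 2 by auto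
    have "x = e \<odot> b' + ((c - e * ?q) \<odot> b + y)" unfolding x(1) by (simp add: algebra_simps)
    also have "\<dots> = c' \<odot> b + (e \<odot> b' + y')" unfolding y'(1) by (simp add: algebra_simps)
    finally show "x \<in> ?B" using y'(2) by auto
  next
    fix x assume "x \<in> ?B"
    then obtain c e y where x: "x = c \<odot> b + (e \<odot> b' + y)" "y \<in> lattice S" by auto
    have "(c + e * ?q) \<odot> b + y \<in> ?L" using x by blast
    then have "(c + e * ?q) \<odot> b + y \<in> ?L'" using 2 by simp
    then obtain c' y' where y': "(c + e * ?q) \<odot> b + y = c' \<odot> b + y'" "y' \<in> lattice (size_reduce b f S)" by blast
    have "x = e \<odot> (b' - ?q \<odot> b) + ((c + e * ?q) \<odot> b + y)" unfolding x(1) by (simp add: algebra_simps)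
    also have "\<dots> = c' \<odot> b + (e \<odot> (b' - ?q \<odot> b) + y')" unfolding y'(1) by (simp add: algebra_simps)
    finally show "x \<in> ?A" using y'(2) by auto
  qed
qed simp

lemma rebased_size_reduce:
  assumes "triangular ((b, d, f) # S)"
  shows "rebased ((b, d, f) # S) ((b, d, f) # size_reduce b f S)"
proof -
  have "triangular (size_reduce b f S)" if "triangular S" "\<forall>(b', d', f') \<in> set S. f' b = 0"
    using that
  proof (induction S rule: triangular.induct)
    case (2 b' d' f' S)
    have "f'' (b' - round (f b') \<odot> b) = 0" if "(b'', d'', f'') \<in> set (size_reduce b f S)" for b'' d'' f''
    proof -
      from size_reduce_mem[OF that] obtain a where a: "(a, d'', f'') \<in> set S" by auto
      then have "linear_form f''" "f'' b = 0" "f'' b' = 0" using 2(2,3) triangular_memD[of S a d'' f''] by auto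
      then show ?thesis by (simp add: linear_formD)
    qed
    then show ?case using 2 by (auto simp: linear_formD)
  qed simp
  moreover have "\<forall>(b', d', f') \<in> set (size_reduce b f S). f' b = 0"
    using assms by (auto dest!: size_reduce_mem)
  moreover have "form (size_reduce b f S) = form S" "disc (size_reduce b f S) = disc S"
    by (auto simp: form_def disc_def size_reduce_def fun_eq_iff case_prod_unfold o_def)
  ultimately show ?thesis
    using assms lattice_size_reduce[of b f S] by (simp add: rebased_def fun_eq_iff)
qed

lemma size_reduce_bound:
  assumes "triangular ((b, d, f) # S)" "(b', d', f') \<in> set (size_reduce b f S)"
  shows "\<bar>f b'\<bar> \<le> 1/2"
proof -
  from size_reduce_mem[OF assms(2)] obtain a where "b' = a - round (f a) \<odot> b" by auto
  then have "f b' = f a - of_int (round (f a))" using assms(1) by (simp add: linear_formD)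
  then show ?thesis using of_int_round_abs_le[of "f a"] by linarith
qed

lemma reduced_size_reduce:
  assumes "\<forall>(b', d', f') \<in> set S. f' b = 0" "triangular S" "reduced S"
  shows "reduced (size_reduce b f S)"
  using assms
proof (induction S rule: triangular.induct)
  case (2 b' d' f' S)
  have "\<bar>f' b''\<bar> \<le> 1/2 \<and> d' \<le> 2 ^ length S * d''" if m: "(b'', d'', f'') \<in> set (size_reduce b f S)" for b'' d'' f''
  proof -
    from size_reduce_mem[OF m] obtain a where a: "(a, d'', f'') \<in> set S" "b'' = a - round (f a) \<odot> b" by auto
    have "f' b'' = f' a" using a(2) 2(2,3) by (simp add: linear_formD)
    then show ?thesis using a(1) 2(4) by auto
  qed
  then show ?case using 2 by auto
qed simp

text \<open>
  Exchanging the first two basis vectors is a change of orthogonal frame in a plane: the new first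
  weight \<open>D\<close> is the value of the two-dimensional form at \<open>b\<^sub>1\<close>, and the second is forced by the
  conservation of the discriminant. The new coordinate forms are the projection to \<open>b\<^sub>1\<close> and what
  remains of \<open>b\<^sub>0\<close>.
\<close>

lemma rebased_swap:
  assumes tri: "triangular ((b0, d0, f0) # (b1, d1, f1) # S)"
  defines "\<mu> \<equiv> f0 b1"
  defines "D \<equiv> d0 * \<mu>\<^sup>2 + d1"
  shows "rebased ((b0, d0, f0) # (b1, d1, f1) # S)
     ((b1, D, \<lambda>x. (d0 * \<mu> * f0 x + d1 * f1 x) / D) # (b0, d0 * d1 / D, \<lambda>x. f0 x - \<mu> * f1 x) # S)"
proof -
  have pos: "0 < d0" "0 < d1" and lin: "linear_form f0" "linear_form f1"
    and val: "f0 b0 = 1" "f1 b1 = 1" "f1 b0 = 0" using tri by auto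
  have D: "0 < D" using pos by (simp add: D_def add_nonneg_pos)
  have "linear_form (\<lambda>x. (d0 * \<mu> * f0 x + d1 * f1 x) / D)" "linear_form (\<lambda>x. f0 x - \<mu> * f1 x)"
    using linear_formD[OF lin(1)] linear_formD[OF lin(2)]
    by (auto simp: linear_form_def algebra_simps add_divide_distrib)
  moreover have "(d0 * \<mu> * f0 b1 + d1 * f1 b1) / D = 1"
    using D val by (simp add: D_def \<mu>_def power2_eq_square)
  ultimately have t: "triangular ((b1, D, \<lambda>x. (d0 * \<mu> * f0 x + d1 * f1 x) / D) # (b0, d0 * d1 / D, \<lambda>x. f0 x - \<mu> * f1 x) # S)"
    using tri D val by (auto simp: \<mu>_def)
  have q: "D * ((d0 * \<mu> * a + d1 * c) / D)\<^sup>2 + d0 * d1 / D * (a - \<mu> * c)\<^sup>2 = d0 * a\<^sup>2 + d1 * c\<^sup>2" for a c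
  proof -
    have "D * ((d0 * \<mu> * a + d1 * c) / D)\<^sup>2 + d0 * d1 / D * (a - \<mu> * c)\<^sup>2
        = ((d0 * \<mu> * a + d1 * c)\<^sup>2 + d0 * d1 * (a - \<mu> * c)\<^sup>2) / D"
      using D by (simp add: field_simps power2_eq_square)
    also have "(d0 * \<mu> * a + d1 * c)\<^sup>2 + d0 * d1 * (a - \<mu> * c)\<^sup>2 = D * (d0 * a\<^sup>2 + d1 * c\<^sup>2)"
      unfolding D_def by (simp add: algebra_simps power2_eq_square)
    finally show ?thesis using D by simp
  qed
  have l: "lattice ((b1, e1, g1) # (b0, e0, g0) # S) \<subseteq> lattice ((b0, e0', g0') # (b1, e1', g1') # S)" for b0 b1 e0 e1 e0' e1' g0 g1 g0' g1'
  proof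
    fix x assume "x \<in> lattice ((b1, e1, g1) # (b0, e0, g0) # S)"
    then obtain c c' y where x: "x = c \<odot> b1 + (c' \<odot> b0 + y)" "y \<in> lattice S" by auto
    have "x = c' \<odot> b0 + (c \<odot> b1 + y)" unfolding x by (simp add: algebra_simps)
    then show "x \<in> lattice ((b0, e0', g0') # (b1, e1', g1') # S)" using x(2) by auto
  qed
  show ?thesis
    unfolding rebased_def
  proof (intro conjI t)
    show "form ((b1, D, \<lambda>x. (d0 * \<mu> * f0 x + d1 * f1 x) / D) # (b0, d0 * d1 / D, \<lambda>x. f0 x - \<mu> * f1 x) # S)
      = form ((b0, d0, f0) # (b1, d1, f1) # S)"
    proof
      fix x
      show "form ((b1, D, \<lambda>x. (d0 * \<mu> * f0 x + d1 * f1 x) / D) # (b0, d0 * d1 / D, \<lambda>x. f0 x - \<mu> * f1 x) # S) x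
        = form ((b0, d0, f0) # (b1, d1, f1) # S) x"
        using q[of "f0 x" "f1 x"] by (simp only: form_simps)
    qed
  next
    show "lattice ((b1, D, \<lambda>x. (d0 * \<mu> * f0 x + d1 * f1 x) / D) # (b0, d0 * d1 / D, \<lambda>x. f0 x - \<mu> * f1 x) # S)
      = lattice ((b0, d0, f0) # (b1, d1, f1) # S)"
      by (rule equalityI; rule l)
  qed (use D in simp_all)
qed

text \<open>
  This is the reduction of Lenstra, Lenstra and Lovasz with the termination argument replaced by an
  infimum. The head weights of all systems equivalent to \<open>S\<close> are values of the form at nonzero
  lattice points, hence bounded below by a positive number, and one can start from a system whose
  head weight is within a factor \<open>4/3\<close> of the infimum. After the tail has been reduced by induction
  and size-reduced against the head, a second weight below half of the first would make the swapped system
  have head weight less than \<open>1/4 + 1/2 = 3/4\<close> of the original, which is below the infimum.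
\<close>

lemma reduced_basis_exists:
  assumes "triangular S"
  shows "\<exists>S'. rebased S S' \<and> reduced S'"
  using assms
proof (induction "length S" arbitrary: S)
  case 0
  then show ?case by (auto intro: exI[of _ "[]"] simp: rebased_def)
next
  case (Suc k)
  define H where "H = {d. \<exists>b f T. rebased S ((b, d, f) # T)}"
  obtain m where m: "m > 0" "\<And>x. x \<in> lattice S \<Longrightarrow> x \<noteq> 0 \<Longrightarrow> m \<le> form S x"
    using form_positive_minimum[OF Suc(3)] by blast
  have Hm: "m \<le> d" if "d \<in> H" for d
    using that m(2) rebased_head unfolding H_def by fastforce
  obtain t S0 where "S = t # S0" using Suc(2) by (cases S) auto
  then have "H \<noteq> {}" using rebased_refl[OF Suc(3)] unfolding H_def by (cases t) auto
  then have "m \<le> Inf H" using Hm by (intro cInf_greatest) auto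
  then have "Inf H < 4/3 * Inf H" using m(1) by linarith
  then obtain d where d: "d \<in> H" "d < 4/3 * Inf H"
    using cInf_lessD[OF \<open>H \<noteq> {}\<close>] by blast
  have least: "3/4 * d < d'" if "d' \<in> H" for d'
    using cInf_lower[OF that bdd_belowI[of H m, OF Hm]] d(2) by linarith
  obtain b f T where T: "rebased S ((b, d, f) # T)" using d(1) unfolding H_def by auto
  then have triT: "triangular ((b, d, f) # T)" "length T = k"
    using Suc(2) by (auto simp: rebased_def)
  then obtain U where U: "rebased T U" "reduced U" using Suc(1)[of T] by auto
  define V where "V = size_reduce b f U"
  have bU: "rebased ((b, d, f) # T) ((b, d, f) # U)" by (rule rebased_Cons[OF triT(1) U(1)])
  then have triU: "triangular ((b, d, f) # U)" by (simp add: rebased_def)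
  have "rebased ((b, d, f) # U) ((b, d, f) # V)" unfolding V_def by (rule rebased_size_reduce[OF triU])
  then have V: "rebased S ((b, d, f) # V)" using T bU rebased_trans by blast
  have lenV: "length V = k" using U(1) triT(2) by (simp add: V_def rebased_def)
  have redV: "reduced V" unfolding V_def using triU U(2) by (intro reduced_size_reduce) auto
  have size: "\<bar>f b'\<bar> \<le> 1/2" if "(b', d', f') \<in> set V" for b' d' f'
    using size_reduce_bound[OF triU] that unfolding V_def by blast
  have "d \<le> 2 ^ length V * d'" if "(b', d', f') \<in> set V" for b' d' f'
  proof (cases V)
    case Nil
    then show ?thesis using that by simp
  next
    case (Cons t W)
    obtain b1 d1 f1 where t: "t = (b1, d1, f1)" by (cases t)
    note V' = V[unfolded Cons t]
    have tri: "triangular ((b, d, f) # (b1, d1, f1) # W)" using V' by (simp add: rebased_def)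
    have "d * (f b1)\<^sup>2 + d1 \<in> H"
      using rebased_trans[OF V' rebased_swap[OF tri]] unfolding H_def by blast
    then have "3/4 * d < d * (f b1)\<^sup>2 + d1" by (rule least)
    moreover have "d * (f b1)\<^sup>2 \<le> d * (1/4)"
    proof -
      have "\<bar>f b1\<bar> \<le> 1/2" using size[of b1 d1 f1] Cons t by simp
      then have "(f b1)\<^sup>2 \<le> (1/2)\<^sup>2" by (metis abs_ge_zero power2_abs power_mono)
      then show ?thesis using tri by (intro mult_left_mono) (auto simp: power2_eq_square)
    qed
    ultimately have dd1: "d \<le> 2 * d1" by linarith
    show ?thesis
    proof (cases "d' = d1")
      case True
      have "1 * d1 \<le> 2 ^ length W * d1" using tri by (intro mult_right_mono) auto
      then have "2 * d1 \<le> 2 ^ length V * d1" using Cons by simp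
      then show ?thesis using dd1 True by simp
    next
      case False
      then have "(b', d', f') \<in> set W" using that Cons t by auto
      then have "d1 \<le> 2 ^ length W * d'" using redV Cons t by auto
      then show ?thesis using dd1 Cons by simp
    qed
  qed
  then have "reduced ((b, d, f) # V)" using size redV by auto
  then show ?case using V by blast
qed

section \<open>Coefficients and weights of reduced bases\<close>

abbreviation vec where "vec t \<equiv> fst t"
abbreviation weight where "weight t \<equiv> fst (snd t)"

lemma linear_form_sum:
  assumes "linear_form f"
  shows "f (\<Sum>i\<in>I. c i \<odot> v i) = (\<Sum>i\<in>I. of_int (c i) * f (v i))"
  by (induction I rule: infinite_finite_induct) (auto simp: linear_formD[OF assms])

text \<open>
  For a reduced system the triangular coordinate change can be inverted at bounded cost. The value
  of the form bounds each coordinate \<open>\<bar>f\<^sub>i x\<bar>\<close> by \<open>sqrt (form S x / d\<^sub>i)\<close>; back substitution from the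
  last coefficient upwards then loses a constant in each step, since the later weights are not much
  smaller than the earlier ones and \<open>\<bar>f\<^sub>i (b\<^sub>j)\<bar> \<le> 1/2\<close>. The constant depends on the rank only.
\<close>

lemma reduced_coefficients:
  "\<exists>K\<ge>1. \<forall>S x. length S = k \<and> triangular S \<and> reduced S \<and> x \<in> lattice S \<longrightarrow>
     (\<exists>c. x = (\<Sum>i<k. c i \<odot> vec (S ! i)) \<and>
          (\<forall>i<k. \<bar>of_int (c i)\<bar> \<le> K * sqrt (form S x / weight (S ! i))))"
proof (induction k)
  case 0
  then show ?case by (intro exI[of _ 1]) auto
next
  case (Suc k)
  then obtain K where K: "K \<ge> 1" and IH: "\<And>S x. length S = k \<Longrightarrow> triangular S \<Longrightarrow> reduced S \<Longrightarrow> x \<in> lattice S \<Longrightarrow>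
     \<exists>c. x = (\<Sum>i<k. c i \<odot> vec (S ! i)) \<and>
          (\<forall>i<k. \<bar>of_int (c i)\<bar> \<le> K * sqrt (form S x / weight (S ! i)))" by blast
  define K' where "K' = 1 + real k * (K * 2 ^ k)"
  have KK': "K \<le> K + K'" "K' \<le> K + K'" using K by (auto simp: K'_def)
  have "\<exists>c. x = (\<Sum>i<Suc k. c i \<odot> vec (S ! i)) \<and>
          (\<forall>i<Suc k. \<bar>of_int (c i)\<bar> \<le> (K + K') * sqrt (form S x / weight (S ! i)))"
    if len: "length S = Suc k" and tri: "triangular S" and red: "reduced S" and x: "x \<in> lattice S" for S x
  proof -
    obtain b d f T where S: "S = (b, d, f) # T" using len by (cases S) auto
    obtain e y where y: "x = e \<odot> b + y" "y \<in> lattice T" using x S by auto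
    define Q where "Q = form S x"
    have d: "d > 0" and triT: "triangular T" and f: "linear_form f" "f b = 1" using tri S by auto
    have "form T x = form T y" using form_tail_cong[of T b e y] tri S y(1) by simp
    then have Qy: "form T y \<le> Q" and dQ: "d * (f x)\<^sup>2 \<le> Q"
      using d form_nonneg[OF triT] by (auto simp: Q_def S)
    have Q0: "Q \<ge> 0" using form_nonneg[OF tri] by (simp add: Q_def)
    obtain c where c: "y = (\<Sum>i<k. c i \<odot> vec (T ! i))"
        "\<And>i. i < k \<Longrightarrow> \<bar>of_int (c i)\<bar> \<le> K * sqrt (form T y / weight (T ! i))"
      using IH[of T y] triT red len S y(2) by auto
    have mem: "0 < weight (T ! i)" "d \<le> 2 ^ k * weight (T ! i)" "\<bar>f (vec (T ! i))\<bar> \<le> 1/2" if i: "i < k" for i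
    proof -
      obtain b' d' f' where t: "T ! i = (b', d', f')" by (cases "T ! i")
      then have "(b', d', f') \<in> set T" using i len S by (metis length_Cons nat.inject nth_mem)
      then show "0 < weight (T ! i)" "d \<le> 2 ^ k * weight (T ! i)" "\<bar>f (vec (T ! i))\<bar> \<le> 1/2"
        using t triangular_memD[OF triT] red S len by auto
    qed
    have cQ: "\<bar>of_int (c i)\<bar> \<le> K * sqrt (Q / weight (T ! i))" if i: "i < k" for i
    proof -
      have "sqrt (form T y / weight (T ! i)) \<le> sqrt (Q / weight (T ! i))"
        using mem[OF i] Qy by (simp add: divide_right_mono)
      then show ?thesis using c(2)[OF i] K by (meson mult_left_mono order_trans zero_le_one)
    qed
    have cf: "\<bar>of_int (c i) * f (vec (T ! i))\<bar> \<le> K * 2 ^ k * sqrt (Q / d)" if i: "i < k" for i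
    proof -
      have "Q / weight (T ! i) \<le> 2 ^ k * (Q / d)"
      proof -
        have "Q * d \<le> Q * (2 ^ k * weight (T ! i))" using mem[OF i] Q0 by (intro mult_left_mono) auto
        then show ?thesis using mem[OF i] d by (simp add: field_simps)
      qed
      also have "\<dots> \<le> (2 ^ k)\<^sup>2 * (Q / d)" using Q0 d
        by (intro mult_right_mono) (auto simp: self_le_power)
      finally have "sqrt (Q / weight (T ! i)) \<le> sqrt ((2 ^ k)\<^sup>2 * (Q / d))" by simp
      also have "\<dots> = 2 ^ k * sqrt (Q / d)" by (simp only: real_sqrt_mult real_sqrt_abs) simp
      finally have "K * sqrt (Q / weight (T ! i)) \<le> K * (2 ^ k * sqrt (Q / d))" using K by simp
      then have 1: "\<bar>of_int (c i)\<bar> \<le> K * 2 ^ k * sqrt (Q / d)" using cQ[OF i] by linarith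
      have "\<bar>of_int (c i) * f (vec (T ! i))\<bar> \<le> \<bar>of_int (c i)\<bar> * 1"
        unfolding abs_mult using mem(3)[OF i] by (intro mult_left_mono) auto
      then show ?thesis using 1 by linarith
    qed
    have "f x = of_int e + (\<Sum>i<k. of_int (c i) * f (vec (T ! i)))"
      unfolding y(1) c(1) by (simp add: linear_formD[OF f(1)] linear_form_sum[OF f(1)] f(2))
    moreover have "\<bar>\<Sum>i<k. of_int (c i) * f (vec (T ! i))\<bar> \<le> (\<Sum>i<k. K * 2 ^ k * sqrt (Q / d))"
      by (rule order_trans[OF sum_abs sum_mono]) (use cf in auto)
    moreover have "\<bar>f x\<bar> \<le> sqrt (Q / d)"
      using dQ d by (intro real_le_rsqrt) (simp add: field_simps)
    ultimately have e: "\<bar>of_int e\<bar> \<le> K' * sqrt (Q / d)" by (simp add: K'_def algebra_simps)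
    define c' where "c' i = (case i of 0 \<Rightarrow> e | Suc j \<Rightarrow> c j)" for i
    have "x = (\<Sum>i<Suc k. c' i \<odot> vec (S ! i))"
      unfolding sum.lessThan_Suc_shift using y(1) c(1) by (simp add: c'_def S)
    moreover have "\<bar>of_int (c' i)\<bar> \<le> (K + K') * sqrt (Q / weight (S ! i))" if i: "i < Suc k" for i
    proof (cases i)
      case 0
      have "K' * sqrt (Q / d) \<le> (K + K') * sqrt (Q / d)" using KK' Q0 d by (intro mult_right_mono) auto
      then show ?thesis using e 0 by (simp add: c'_def S)
    next
      case (Suc j)
      have "K * sqrt (Q / weight (T ! j)) \<le> (K + K') * sqrt (Q / weight (T ! j))"
        using KK' Q0 mem(1)[of j] Suc i by (intro mult_right_mono) auto
      then show ?thesis using cQ[of j] Suc i by (simp add: c'_def S)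
    qed
    ultimately show ?thesis unfolding Q_def by blast
  qed
  moreover have "1 \<le> K + K'" using K by (simp add: K'_def)
  ultimately show ?case by blast
qed

lemma sqrt_prod: "sqrt (\<Prod>i\<in>I. c i) = (\<Prod>i\<in>I. sqrt (c i))"
  by (induction I rule: infinite_finite_induct) (simp_all add: real_sqrt_mult)

lemma disc_nth: "disc S = (\<Prod>i<length S. weight (S ! i))"
  by (simp add: disc_def case_prod_unfold prod.list_conv_set_nth lessThan_atLeast0)

text \<open>
  The first weight is the value of the form at a lattice vector, so the hypothesis bounds it from
  below, and by reducedness all weights are then bounded below. As the product of the weights is the
  discriminant, no single weight can be large.
\<close>

lemma reduced_weights_le_1:
  assumes "triangular S" "reduced S" "length S = k"
    and short: "\<And>x. x \<in> lattice S \<Longrightarrow> x \<noteq> 0 \<Longrightarrow> 2 ^ (k * k) * disc S \<le> form S x ^ (k - 1)"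
    and j: "j < k"
  shows "weight (S ! j) \<le> 1"
proof -
  obtain b d f T where S: "S = (b, d, f) # T" using assms(3) j by (cases S) auto
  have reb: "rebased S ((b, d, f) # T)" using rebased_refl[OF assms(1)] S by simp
  have d: "2 ^ (k * k) * disc S \<le> d ^ (k - 1)"
    using short rebased_head[OF reb] by metis
  have d0: "0 < d" using assms(1) S by auto
  have pos: "0 < weight (S ! i)" if "i < k" for i
  proof -
    have "S ! i \<in> set S" using that assms(3) by simp
    then show ?thesis using triangular_memD[OF assms(1)] by (metis prod.collapse)
  qed
  have low: "d / 2 ^ k \<le> weight (S ! i)" if i: "i < k" for i
  proof (cases i)
    case 0
    then show ?thesis using S d0 by (simp add: field_simps)
  next
    case (Suc i')
    have "S ! i \<in> set T" using i assms(3) Suc S by auto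
    then have "d \<le> 2 ^ length T * weight (S ! i)" using assms(2) S by (auto simp: case_prod_unfold)
    also have "\<dots> \<le> 2 ^ k * weight (S ! i)"
      using pos[OF i] assms(3) S by (intro mult_right_mono power_increasing) auto
    finally show ?thesis by (simp add: field_simps)
  qed
  have "(d / 2 ^ k) ^ (k - 1) = (\<Prod>i\<in>{..<k} - {j}. d / 2 ^ k)" using j by simp
  also have "\<dots> \<le> (\<Prod>i\<in>{..<k} - {j}. weight (S ! i))"
    using low d0 by (intro prod_mono) auto
  finally have P: "(d / 2 ^ k) ^ (k - 1) \<le> (\<Prod>i\<in>{..<k} - {j}. weight (S ! i))" .
  have "weight (S ! j) * (d / 2 ^ k) ^ (k - 1) \<le> weight (S ! j) * (\<Prod>i\<in>{..<k} - {j}. weight (S ! i))"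
    using P pos[OF j] by (intro mult_left_mono) auto
  also have "\<dots> = disc S" using j by (simp add: disc_nth assms(3) prod.remove[of "{..<k}" j])
  also have "disc S \<le> d ^ (k - 1) / 2 ^ (k * k)" using d by (simp add: field_simps)
  also have "\<dots> \<le> d ^ (k - 1) / 2 ^ (k * (k - 1))"
    using d0 by (intro divide_left_mono power_increasing) auto
  also have "\<dots> = (d / 2 ^ k) ^ (k - 1)" by (simp add: power_divide power_mult)
  finally have "weight (S ! j) * (d / 2 ^ k) ^ (k - 1) \<le> 1 * (d / 2 ^ k) ^ (k - 1)" by simp
  then show ?thesis using d0 by (simp only: mult_le_cancel_right) (simp add: not_less)
qed

text \<open>
  The steps of the progression are, up to sign, the values of \<open>h\<close> at a reduced basis
  \<open>b\<^sub>1, \<dots>, b\<^sub>k\<close>, and the lengths are the coefficient bounds \<open>B\<^sub>i = K * sqrt (R / d\<^sub>i)\<close>. Because the weights \<open>d\<^sub>i\<close> are at most \<open>1\<close>,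
  rounding \<open>B\<^sub>i\<close> up to a positive integer costs a constant factor, so the number of
  coefficient vectors is a constant times \<open>1 / sqrt (d\<^sub>1 \<cdots> d\<^sub>k)\<close>.
\<close>

lemma progression_cover:
  assumes R: "R \<ge> 1"
  shows "\<exists>C>0. \<forall>S h. triangular S \<and> length S = k \<and> linear_form (\<lambda>x. real_of_int (h x)) \<and>
       (\<forall>x\<in>lattice S. x \<noteq> 0 \<longrightarrow> 2 ^ (k * k) * disc S \<le> form S x ^ (k - 1)) \<longrightarrow>
     (\<exists>A L. (\<forall>i\<in>{1..k}. A i \<ge> 1 \<and> L i \<ge> 1) \<and>
        h ` {x \<in> lattice S. form S x \<le> R} \<subseteq> gap k 0 A L \<and>
        real (card (gap k 0 A L)) \<le> C / sqrt (disc S))"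
proof -
  obtain K where K: "K \<ge> 1" and coeff: "\<And>S x. length S = k \<Longrightarrow> triangular S \<Longrightarrow> reduced S \<Longrightarrow> x \<in> lattice S \<Longrightarrow>
     \<exists>c. x = (\<Sum>i<k. c i \<odot> vec (S ! i)) \<and>
          (\<forall>i<k. \<bar>of_int (c i)\<bar> \<le> K * sqrt (form S x / weight (S ! i)))"
    using reduced_coefficients[of k] by blast
  have "\<exists>A L. (\<forall>i\<in>{1..k}. A i \<ge> 1 \<and> L i \<ge> 1) \<and>
        h ` {x \<in> lattice S. form S x \<le> R} \<subseteq> gap k 0 A L \<and>
        real (card (gap k 0 A L)) \<le> (5 * K * sqrt R) ^ k / sqrt (disc S)"
    if "triangular S" "length S = k" and h: "linear_form (\<lambda>x. real_of_int (h x))"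
       and short: "\<forall>x\<in>lattice S. x \<noteq> 0 \<longrightarrow> 2 ^ (k * k) * disc S \<le> form S x ^ (k - 1)" for S h
  proof -
    obtain T where T: "rebased S T" "reduced T" using reduced_basis_exists \<open>triangular S\<close> by blast
    then have T': "triangular T" "length T = k" "lattice T = lattice S" "form T = form S" "disc T = disc S"
      using \<open>length S = k\<close> by (auto simp: rebased_def)
    define B where "B i = K * sqrt (R / weight (T ! i))" for i
    define L where "L i = nat \<lceil>B (i - 1)\<rceil>" for i
    define g where "g i = h (vec (T ! (i - 1)))" for i
    \<comment> \<open>A step must be positive. A zero step is replaced by 1, and the sign of \<open>g i\<close> goes into the coefficient.\<close>
    define A where "A i = (if g i = 0 then 1 else nat \<bar>g i\<bar>)" for i
    have w: "0 < weight (T ! i)" "weight (T ! i) \<le> 1" if i: "i < k" for i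
    proof -
      show "0 < weight (T ! i)" using triangular_memD[OF T'(1)] i T'(2) by (metis nth_mem prod.collapse)
      show "weight (T ! i) \<le> 1"
        using reduced_weights_le_1[OF T'(1) T(2) T'(2) _ i] short T' by auto
    qed
    have B: "1 \<le> B i" if i: "i < k" for i
    proof -
      have "1 \<le> sqrt (R / weight (T ! i))" using w[OF i] R by simp
      then have "1 * 1 \<le> B i" unfolding B_def using K by (intro mult_mono) auto
      then show ?thesis by simp
    qed
    have ex: "\<forall>i\<in>{1..k}. A i \<ge> 1 \<and> L i \<ge> 1"
    proof
      fix i assume "i \<in> {1..k}"
      then have "1 \<le> B (i - 1)" using B[of "i - 1"] by auto
      then have "1 \<le> L i" unfolding L_def by linarith
      then show "A i \<ge> 1 \<and> L i \<ge> 1" by (auto simp: A_def)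
    qed
    have "h x \<in> gap k 0 A L" if x: "x \<in> lattice S" "form S x \<le> R" for x
    proof -
      obtain c where c: "x = (\<Sum>i<k. c i \<odot> vec (T ! i))"
          "\<And>i. i < k \<Longrightarrow> \<bar>of_int (c i)\<bar> \<le> K * sqrt (form S x / weight (T ! i))"
        using coeff[OF T'(2,1) T(2), of x] x(1) T'(3,4) by auto
      define n where "n i = sgn (g i) * c (i - 1)" for i
      have "real_of_int (h x) = (\<Sum>i<k. of_int (c i) * of_int (h (vec (T ! i))))"
        unfolding c(1) by (rule linear_form_sum[OF h])
      also have "\<dots> = of_int (\<Sum>i<k. c i * h (vec (T ! i)))" by simp
      finally have "h x = (\<Sum>i<k. c i * h (vec (T ! i)))" by (simp only: of_int_eq_iff)
      also have "\<dots> = (\<Sum>i=1..k. c (i - 1) * g i)"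
        by (rule sum.reindex_bij_witness[of _ "\<lambda>i. i - 1" Suc]) (auto simp: g_def)
      also have "\<dots> = (\<Sum>i=1..k. int (A i) * n i)"
      proof (rule sum.cong)
        fix i
        have "int (A i) * sgn (g i) = g i" by (simp add: A_def abs_mult_sgn)
        then show "c (i - 1) * g i = int (A i) * n i" unfolding n_def by (metis mult.assoc mult.commute)
      qed simp
      finally have "h x = int 0 + (\<Sum>i=1..k. int (A i) * n i)" by simp
      moreover have "\<bar>n i\<bar> \<le> int (L i)" if i: "i \<in> {1..k}" for i
      proof -
        have i': "i - 1 < k" using i by auto
        have "sqrt (form S x / weight (T ! (i - 1))) \<le> sqrt (R / weight (T ! (i - 1)))"
          using w[OF i'] x(2) by (simp add: divide_right_mono)
        then have "\<bar>of_int (c (i - 1))\<bar> \<le> B (i - 1)"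
          using c(2)[OF i'] K unfolding B_def by (meson mult_left_mono order_trans zero_le_one)
        then have "\<bar>c (i - 1)\<bar> \<le> \<lceil>B (i - 1)\<rceil>" by linarith
        moreover have "\<bar>n i\<bar> \<le> \<bar>c (i - 1)\<bar>" by (simp add: n_def abs_mult sgn_if)
        ultimately show ?thesis unfolding L_def by linarith
      qed
      ultimately show ?thesis unfolding gap_def by blast
    qed
    moreover have "real (card (gap k 0 A L)) \<le> (5 * K * sqrt R) ^ k / sqrt (disc S)"
    proof -
      have "real (card (gap k 0 A L)) \<le> real (\<Prod>i=1..k. 2 * L i + 1)"
        using card_gap_le of_nat_le_iff by blast
      also have "\<dots> = (\<Prod>i=1..k. 2 * real (L i) + 1)" by (simp add: add.commute)
      also have "\<dots> \<le> (\<Prod>i=1..k. 5 * B (i - 1))"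
      proof (intro prod_mono conjI)
        fix i assume "i \<in> {1..k}"
        then have "1 \<le> B (i - 1)" using B[of "i - 1"] by auto
        \<comment> \<open>As \<open>L i \<le> B (i - 1) + 1\<close>, the left side is at most \<open>2 * B (i - 1) + 3\<close>.\<close>
        then show "2 * real (L i) + 1 \<le> 5 * B (i - 1)" unfolding L_def by linarith
      qed auto
      also have "\<dots> = (\<Prod>i<k. 5 * B i)"
        by (rule prod.reindex_bij_witness[of _ Suc "\<lambda>i. i - 1"]) auto
      also have "\<dots> = (\<Prod>i<k. 5 * K * sqrt R / sqrt (weight (T ! i)))"
        by (simp add: B_def real_sqrt_divide mult.assoc)
      also have "\<dots> = (5 * K * sqrt R) ^ k / (\<Prod>i<k. sqrt (weight (T ! i)))"
        by (simp add: prod_dividef)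
      also have "(\<Prod>i<k. sqrt (weight (T ! i))) = sqrt (disc S)"
        using disc_nth[of T] T'(2,5) by (simp add: sqrt_prod)
      finally show ?thesis .
    qed
    ultimately show ?thesis using ex by blast
  qed
  moreover have "0 < (5 * K * sqrt R) ^ k" using K R by simp
  ultimately show ?thesis by blast
qed

end

section \<open>The Diophantine condition\<close>

lemma dist_nearest_int_nonneg: "0 \<le> dist_nearest_int x"
  by (simp add: dist_nearest_int_def)

lemma dist_nearest_int_le: "dist_nearest_int x \<le> \<bar>x - of_int m\<bar>"
  unfolding dist_nearest_int_def by (rule round_diff_minimal)

lemma dist_nearest_int_minus_le: "dist_nearest_int (- x) \<le> dist_nearest_int x"
  using dist_nearest_int_le[of "- x" "- round x"] unfolding dist_nearest_int_def by simp

lemma dist_nearest_int_abs: "dist_nearest_int (real (nat \<bar>n\<bar>) * a) = dist_nearest_int (of_int n * a)"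
proof -
  have "dist_nearest_int (- x) = dist_nearest_int x" for x
    using dist_nearest_int_minus_le[of x] dist_nearest_int_minus_le[of "- x"] by simp
  from this[of "of_int n * a"] show ?thesis by (cases "n \<ge> 0") auto
qed

lemma dist_nearest_int_multiple:
  assumes "dist_nearest_int x = 0"
  shows "dist_nearest_int (of_nat m * x) = 0"
proof -
  have "x = of_int (round x)" using assms by (simp add: dist_nearest_int_def)
  then have "of_nat m * x = of_int (int m * round x)" by simp
  then have "\<bar>of_nat m * x - of_int (int m * round x)\<bar> = 0" by linarith
  then have "dist_nearest_int (of_nat m * x) \<le> 0"
    using dist_nearest_int_le[of "of_nat m * x" "int m * round x"] by linarith
  then show ?thesis using dist_nearest_int_nonneg[of "of_nat m * x"] by linarith
qed

text \<open>
  Beyond the exponent there are only finitely many exceptional \<open>n\<close>, which the constant absorbs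
  provided that their products do not vanish. They cannot: if some \<open>n * \<alpha> i\<close> is an integer, then so are
  all its multiples, and there would be infinitely many exceptions.
\<close>

lemma mult_exponent_lower_bound:
  assumes "mult_exponent k \<alpha> < ereal w"
  shows "\<exists>c>0. \<forall>n\<ge>1. c * real n powr (- w) \<le> (\<Prod>i=1..k-1. dist_nearest_int (real n * \<alpha> i))"
proof -
  define p where "p n = (\<Prod>i=1..k-1. dist_nearest_int (real n * \<alpha> i))" for n :: nat
  define E where "E = {n::nat. n \<ge> 1 \<and> p n < real n powr (- w)}"
  have fin: "finite E"
  proof (rule ccontr)
    assume "infinite E"
    then have "ereal w \<le> mult_exponent k \<alpha>"
      unfolding mult_exponent_def E_def p_def by (intro Sup_upper) auto
    then show False using assms by simp
  qed
  have p0: "p n > 0" if n: "n \<ge> 1" for n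
  proof (rule ccontr)
    assume "\<not> p n > 0"
    moreover have "p n \<ge> 0" unfolding p_def by (intro prod_nonneg) (simp add: dist_nearest_int_nonneg)
    ultimately obtain i where i: "i \<in> {1..k-1}" "dist_nearest_int (real n * \<alpha> i) = 0"
      unfolding p_def by auto
    have "n * m \<in> E" if "m \<ge> 1" for m
    proof -
      have "dist_nearest_int (real (n * m) * \<alpha> i) = 0"
        using dist_nearest_int_multiple[OF i(2), of m] by (simp add: mult_ac)
      then have "p (n * m) = 0" using i(1) unfolding p_def by (intro prod_zero) auto
      then show ?thesis using n that by (simp add: E_def)
    qed
    then have "(\<lambda>m. n * m) ` {1..} \<subseteq> E" by auto
    moreover have "infinite ((\<lambda>m. n * m) ` {1..})"
      using n by (subst finite_image_iff) (auto simp: inj_on_def infinite_Ici)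
    ultimately show False using fin finite_subset by blast
  qed
  define c where "c = Min (insert 1 ((\<lambda>n. p n * real n powr w) ` E))"
  have "c > 0" unfolding c_def using fin p0 by (subst Min_gr_iff) (auto simp: E_def)
  moreover have "c * real n powr (- w) \<le> p n" if n: "n \<ge> 1" for n
  proof (cases "n \<in> E")
    case True
    then have "c \<le> p n * real n powr w" unfolding c_def using fin by (intro Min_le) auto
    then have "c * real n powr (- w) \<le> p n * real n powr w * real n powr (- w)" by (intro mult_right_mono) auto
    also have "\<dots> = p n" using n by (simp add: powr_minus)
    finally show ?thesis .
  next
    case False
    have "c \<le> 1" unfolding c_def using fin by (intro Min_le) auto
    then have "c * real n powr (- w) \<le> 1 * real n powr (- w)" by (intro mult_right_mono) auto
    moreover have "real n powr (- w) \<le> p n" using False n by (simp add: E_def)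
    ultimately show ?thesis by linarith
  qed
  ultimately show ?thesis unfolding p_def by blast
qed

text \<open>
  Both cases of the hypothesis leave room for a positive \<open>w\<close>, and the product form of the condition
  on \<open>w\<close> also makes sense for \<open>k = 2\<close>.
\<close>

lemma admissible_exponent:
  assumes "k \<ge> 2"
    and "if k = 2 then mult_exponent k \<alpha> < \<infinity>
         else mult_exponent k \<alpha> < ereal ((real k - 1) / (real k - 2))"
  shows "\<exists>w>0. w * (real k - 2) < real k - 1 \<and> mult_exponent k \<alpha> < ereal w"
proof (cases "k = 2")
  case True
  then have "max (mult_exponent k \<alpha>) 0 < \<infinity>" using assms(2) by (simp add: max_def)
  then obtain w where "max (mult_exponent k \<alpha>) 0 < ereal w" "ereal w < \<infinity>" using ereal_dense2 by blast
  then show ?thesis using True by (intro exI[of _ w]) auto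
next
  case False
  then have k: "k > 2" using assms(1) by simp
  then have "max (mult_exponent k \<alpha>) 0 < ereal ((real k - 1) / (real k - 2))" using assms(2) by simp
  then obtain w where w: "max (mult_exponent k \<alpha>) 0 < ereal w" "ereal w < ereal ((real k - 1) / (real k - 2))"
    using ereal_dense2 by blast
  then have "w * (real k - 2) < real k - 1" using k by (simp add: field_simps)
  then show ?thesis using w(1) by (intro exI[of _ w]) auto
qed

section \<open>The lattice of a Bohr set\<close>

interpretation zvec: int_module "\<lambda>(c::int) (x::nat \<Rightarrow> int) i. c * x i"
  by unfold_locales (auto simp: fun_eq_iff algebra_simps)

definition unit_vec :: "nat \<Rightarrow> nat \<Rightarrow> int" where
  "unit_vec i j = (if j = i then 1 else 0)"

text \<open>
  The lattice point \<open>x\<close> stands for the integer \<open>n = x 0\<close> together with integers \<open>x i\<close> that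
  compete to be nearest to \<open>n * \<alpha> i\<close>. The index \<open>0\<close> comes last, since its form vanishes on all other unit
  vectors. The list of indices is a parameter in order to allow induction.
\<close>

definition bohr_system :: "(nat \<Rightarrow> real) \<Rightarrow> nat \<Rightarrow> (nat \<Rightarrow> real) \<Rightarrow> nat list \<Rightarrow>
    (nat \<Rightarrow> int) gs_system" where
  "bohr_system \<alpha> N \<delta> is =
     map (\<lambda>i. (unit_vec i, 1 / (\<delta> i)\<^sup>2, \<lambda>x. of_int (x i) - of_int (x 0) * \<alpha> i)) is
     @ [(unit_vec 0, 1 / (real N)\<^sup>2, \<lambda>x. of_int (x 0))]"

lemma bohr_system_Cons:
  "bohr_system \<alpha> N \<delta> (i # is) =
     (unit_vec i, 1 / (\<delta> i)\<^sup>2, \<lambda>x. of_int (x i) - of_int (x 0) * \<alpha> i) # bohr_system \<alpha> N \<delta> is"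
  by (simp add: bohr_system_def)

lemma triangular_bohr_system:
  assumes "N \<ge> 1" "distinct is" "0 \<notin> set is" "\<forall>i\<in>set is. \<delta> i > 0"
  shows "zvec.triangular (bohr_system \<alpha> N \<delta> is)"
  using assms(2-)
proof (induction "is")
  case Nil
  then show ?case using assms(1) by (simp add: bohr_system_def zvec.linear_form_def unit_vec_def)
next
  case (Cons i "is")
  then have "zvec.triangular (bohr_system \<alpha> N \<delta> is)" by simp
  moreover have "\<forall>(b', d', f') \<in> set (bohr_system \<alpha> N \<delta> is). f' (unit_vec i) = 0"
    using Cons(2,3) by (auto simp: bohr_system_def unit_vec_def)
  moreover have "\<delta> i > 0" "i \<noteq> 0" using Cons by auto
  ultimately show ?case
    by (auto simp: bohr_system_Cons zvec.linear_form_def unit_vec_def algebra_simps)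
qed

lemma lattice_bohr_system:
  assumes "distinct is" "0 \<notin> set is" "\<forall>j. j \<notin> insert 0 (set is) \<longrightarrow> x j = 0"
  shows "x \<in> zvec.lattice (bohr_system \<alpha> N \<delta> is)"
  using assms
proof (induction "is" arbitrary: x)
  case Nil
  have "x = (\<lambda>j. x 0 * unit_vec 0 j) + 0" using Nil by (auto simp: fun_eq_iff unit_vec_def)
  then show ?case by (auto simp: bohr_system_def)
next
  case (Cons i "is")
  have "x(i := 0) \<in> zvec.lattice (bohr_system \<alpha> N \<delta> is)"
    using Cons by auto
  moreover have "x = (\<lambda>j. x i * unit_vec i j) + x(i := 0)" by (auto simp: fun_eq_iff unit_vec_def)
  ultimately show ?case unfolding bohr_system_Cons zvec.lattice.simps by blast
qed

lemma form_bohr_system: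
  assumes "distinct is"
  shows "zvec.form (bohr_system \<alpha> N \<delta> is) x =
    (\<Sum>i\<in>set is. ((of_int (x i) - of_int (x 0) * \<alpha> i) / \<delta> i)\<^sup>2) + (of_int (x 0) / real N)\<^sup>2"
  using assms
  by (induction "is") (simp add: bohr_system_def power_divide, simp add: bohr_system_Cons power_divide)

lemma disc_bohr_system:
  assumes "distinct is"
  shows "zvec.disc (bohr_system \<alpha> N \<delta> is) = 1 / (real N * (\<Prod>i\<in>set is. \<delta> i))\<^sup>2"
  using assms
  by (induction "is") (simp add: bohr_system_def, simp add: bohr_system_Cons power_mult_distrib)

lemma length_bohr_system: "length (bohr_system \<alpha> N \<delta> is) = Suc (length is)"
  by (simp add: bohr_system_def)

text \<open>
  Let \<open>s\<close> be the square root of the form at \<open>x\<close>, so that \<open>\<bar>x 0\<bar> \<le> s N\<close> and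
  \<open>\<bar>x i - x 0 * \<alpha> i\<bar> \<le> s \<delta> i\<close>, and let \<open>P\<close> be the product of the \<open>\<delta> i\<close>. If \<open>x 0 = 0\<close>, then some \<open>x i\<close> is a nonzero integer and \<open>s \<ge> 1/2\<close>.
  Otherwise the Diophantine condition for \<open>\<bar>x 0\<bar>\<close> gives \<open>c (s N) powr -w \<le> s ^ (k-1) P\<close>, a lower
  bound for \<open>s powr (k-1+w)\<close>. Raising it to the power \<open>\<theta> = (k-1) / (k-1+w)\<close> gives
  \<open>s ^ (k-1) N P \<ge> c powr \<theta> * N powr (1 - w \<theta>) * P powr (1 - \<theta>)\<close>. Here \<open>1 - w \<theta> = \<kappa>\<close> is positive exactly
  if \<open>w (k-2) < k-1\<close>, and half of it pays for the smallness of \<open>P\<close>.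
\<close>

lemma bohr_lattice_minimum:
  fixes k :: nat and \<alpha> :: "nat \<Rightarrow> real" and w c \<tau> :: real
  assumes k: "k \<ge> 2" and w: "w > 0" "w * (real k - 2) < real k - 1" and c: "c > 0"
    and exponent: "\<And>n. n \<ge> 1 \<Longrightarrow> c * real n powr (- w) \<le> (\<Prod>i=1..k-1. dist_nearest_int (real n * \<alpha> i))"
  defines "\<kappa> \<equiv> (real k - 1 + w - w * (real k - 1)) / (real k - 1 + w)"
  assumes \<tau>: "(real k - 1) * \<tau> \<le> \<kappa> / 2"
  shows "\<exists>c'>0. \<forall>N \<delta> x. N \<ge> 1 \<and> (\<forall>i\<in>{1..k-1}. real N powr (- \<tau>) \<le> \<delta> i \<and> \<delta> i \<le> 2) \<and>
     0 < zvec.form (bohr_system \<alpha> N \<delta> [1..<k]) x \<longrightarrow>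
     c' * real N powr (\<kappa> / 2) \<le> sqrt (zvec.form (bohr_system \<alpha> N \<delta> [1..<k]) x) ^ (k - 1) * (real N * (\<Prod>i=1..k-1. \<delta> i))"
proof -
  define p where "p = real k - 1"
  define \<theta> where "\<theta> = p / (p + w)"
  have p: "p \<ge> 1" "real (k - 1) = p" using k by (auto simp: p_def)
  have \<theta>: "0 < \<theta>" "\<theta> < 1" using p w by (auto simp: \<theta>_def)
  have \<kappa>: "\<kappa> = 1 - w * \<theta>" using p w by (simp add: \<kappa>_def \<theta>_def p_def field_simps)
  have \<kappa>0: "0 < \<kappa>" unfolding \<kappa>_def using w k by (intro divide_pos_pos) (auto simp: algebra_simps)
  have \<kappa>1: "\<kappa> \<le> 1" using \<kappa> w(1) \<theta>(1) by simp
  define c' where "c' = min (c powr \<theta>) ((1/2) ^ (k - 1))"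
  have "c' > 0" using c by (simp add: c'_def)
  moreover have "c' * real N powr (\<kappa> / 2) \<le> s ^ (k - 1) * (real N * P)"
    if N: "N \<ge> 1" and \<delta>: "\<And>i. i \<in> {1..k-1} \<Longrightarrow> real N powr (- \<tau>) \<le> \<delta> i \<and> \<delta> i \<le> 2"
      and Qpos: "0 < Q" and Q_def: "Q = zvec.form (bohr_system \<alpha> N \<delta> [1..<k]) x"
      and s_def: "s = sqrt Q" and P_def: "P = (\<Prod>i=1..k-1. \<delta> i)" for N \<delta> x Q s P
  proof -
    have set: "set [1..<k] = {1..k-1}" using k by auto
    have Q: "Q = (\<Sum>i=1..k-1. ((of_int (x i) - of_int (x 0) * \<alpha> i) / \<delta> i)\<^sup>2) + (of_int (x 0) / real N)\<^sup>2"
      unfolding Q_def form_bohr_system[OF distinct_upt] set ..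
    have \<delta>0: "0 < \<delta> i" if "i \<in> {1..k-1}" for i
    proof -
      have "0 < real N powr (- \<tau>)" using N by simp
      then show ?thesis using \<delta>[OF that] by linarith
    qed
    have s: "s > 0" "s\<^sup>2 = Q" using Qpos by (auto simp: s_def)
    have coord: "\<bar>of_int (x i) - of_int (x 0) * \<alpha> i\<bar> \<le> s * \<delta> i" if i: "i \<in> {1..k-1}" for i
    proof -
      have "((of_int (x i) - of_int (x 0) * \<alpha> i) / \<delta> i)\<^sup>2 \<le> (\<Sum>i=1..k-1. ((of_int (x i) - of_int (x 0) * \<alpha> i) / \<delta> i)\<^sup>2)"
        by (rule member_le_sum[OF i]) auto
      then have "((of_int (x i) - of_int (x 0) * \<alpha> i) / \<delta> i)\<^sup>2 \<le> s\<^sup>2" using Q s(2) by (smt (verit) zero_le_power2)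
      then have "\<bar>(of_int (x i) - of_int (x 0) * \<alpha> i) / \<delta> i\<bar> \<le> s" by (intro power2_le_imp_le[OF _ less_imp_le[OF s(1)]]) (simp only: power2_abs)
      then show ?thesis using \<delta>0[OF i] by (simp add: field_simps)
    qed
    have P: "P > 0" unfolding P_def using \<delta>0 by (intro prod_pos) auto
    have Plow: "real N powr (- \<kappa> / 2) \<le> P"
    proof -
      have "real N powr (- \<kappa> / 2) \<le> real N powr (- (p * \<tau>))"
        using N \<tau> by (intro powr_mono) (auto simp: p_def)
      also have "\<dots> = (real N powr (- \<tau>)) ^ (k - 1)"
        using N p(2) by (simp add: powr_powr mult.commute flip: powr_realpow)
      also have "\<dots> = (\<Prod>i=1..k-1. real N powr (- \<tau>))" by simp
      also have "\<dots> \<le> P" unfolding P_def using \<delta> by (intro prod_mono) auto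
      finally show ?thesis .
    qed
    show ?thesis
    proof (cases "x 0 = 0")
      case True
      have "\<exists>i\<in>{1..k-1}. x i \<noteq> 0"
      proof (rule ccontr)
        assume "\<not> ?thesis"
        then have "Q = 0" unfolding Q using True by simp
        then show False using Qpos by simp
      qed
      then obtain i where i: "i \<in> {1..k-1}" "x i \<noteq> 0" by blast
      have "1 \<le> \<bar>x i\<bar>" using i(2) by simp
      then have "1 \<le> \<bar>real_of_int (x i)\<bar>" by linarith
      also have "\<dots> \<le> s * \<delta> i" using coord[OF i(1)] True by simp
      also have "\<dots> \<le> s * 2" using \<delta>[OF i(1)] s by (intro mult_left_mono) auto
      finally have "(1/2) ^ (k - 1) \<le> s ^ (k - 1)" by (intro power_mono) auto
      then have c's: "c' \<le> s ^ (k - 1)" by (simp add: c'_def)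
      have "real N powr (\<kappa> / 2) \<le> real N powr (1 + - \<kappa> / 2)" using \<kappa>1 N by (intro powr_mono) auto
      also have "\<dots> = real N * real N powr (- \<kappa> / 2)" using N by (subst powr_add) auto
      also have "\<dots> \<le> real N * P" using Plow by (intro mult_left_mono) auto
      finally show ?thesis using c's \<open>c' > 0\<close> by (intro mult_mono) auto
    next
      case False
      define n where "n = nat \<bar>x 0\<bar>"
      have n: "n \<ge> 1" using False by (simp add: n_def)
      have rn: "real n = \<bar>of_int (x 0)\<bar>" by (simp add: n_def)
      have "(of_int (x 0) / real N)\<^sup>2 \<le> s\<^sup>2" unfolding s(2) Q by (simp add: sum_nonneg)
      then have "\<bar>of_int (x 0) / real N\<bar> \<le> s" by (intro power2_le_imp_le[OF _ less_imp_le[OF s(1)]]) (simp only: power2_abs)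
      then have nN: "real n \<le> s * real N" using N rn by (simp add: field_simps)
      have "c * (s * real N) powr (- w) \<le> c * real n powr (- w)"
        using nN n c w by (intro mult_left_mono powr_mono2') auto
      also have "\<dots> \<le> (\<Prod>i=1..k-1. dist_nearest_int (real n * \<alpha> i))" by (rule exponent[OF n])
      also have "\<dots> \<le> (\<Prod>i=1..k-1. s * \<delta> i)"
      proof (intro prod_mono conjI dist_nearest_int_nonneg)
        fix i assume i: "i \<in> {1..k-1}"
        have "dist_nearest_int (real n * \<alpha> i) \<le> \<bar>of_int (x 0) * \<alpha> i - of_int (x i)\<bar>"
          unfolding n_def dist_nearest_int_abs by (rule dist_nearest_int_le)
        then show "dist_nearest_int (real n * \<alpha> i) \<le> s * \<delta> i" using coord[OF i] by linarith
      qed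
      also have "\<dots> = s powr p * P" using s(1) p(2) by (simp add: P_def prod.distrib flip: powr_realpow)
      finally have "c * (s * real N) powr (- w) * s powr w \<le> s powr p * P * s powr w"
        by (intro mult_right_mono) auto
      then have "c * real N powr (- w) \<le> s powr (p + w) * P"
        using s(1) N by (simp add: powr_mult powr_add powr_minus field_simps)
      then have "(c * real N powr (- w)) powr \<theta> \<le> (s powr (p + w) * P) powr \<theta>"
        using \<theta> c by (intro powr_mono2) auto
      also have "\<dots> = s powr p * P powr \<theta>"
        using p w by (simp add: powr_mult powr_powr \<theta>_def)
      finally have 1: "c powr \<theta> * real N powr (- w * \<theta>) \<le> s powr p * P powr \<theta>"
        using c by (simp add: powr_mult powr_powr)
      have "real N powr (- \<kappa> / 2) \<le> (real N powr (- \<kappa> / 2)) powr (1 - \<theta>)"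
        unfolding powr_powr using N \<kappa>0 \<theta> by (intro powr_mono) (auto simp: algebra_simps)
      also have "\<dots> \<le> P powr (1 - \<theta>)" using Plow \<theta> by (intro powr_mono2) auto
      finally have 2: "real N powr (- \<kappa> / 2) \<le> P powr (1 - \<theta>)" .
      have 3: "real N powr (\<kappa> / 2) = real N powr (- w * \<theta>) * (real N powr 1 * real N powr (- \<kappa> / 2))"
        unfolding powr_add[symmetric] \<kappa> by (rule arg_cong[of _ _ "\<lambda>t. real N powr t"]) (simp add: field_simps)
      have "c' * real N powr (\<kappa> / 2) \<le> c powr \<theta> * real N powr (\<kappa> / 2)"
        by (intro mult_right_mono) (auto simp: c'_def)
      also have "\<dots> = (c powr \<theta> * real N powr (- w * \<theta>)) * (real N * real N powr (- \<kappa> / 2))"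
        using N by (simp add: 3)
      also have "\<dots> \<le> (s powr p * P powr \<theta>) * (real N * P powr (1 - \<theta>))"
        by (rule mult_mono[OF 1 mult_left_mono[OF 2]]) (use c in auto)
      also have "\<dots> = s powr p * (real N * (P powr \<theta> * P powr (1 - \<theta>)))" by simp
      also have "\<dots> = s ^ (k - 1) * (real N * P)"
        using P s(1) p(2) by (simp flip: powr_add powr_realpow)
      finally show ?thesis .
    qed
  qed
  ultimately show ?thesis by blast
qed

text \<open>
  The nearest integers to the \<open>n * \<alpha> i\<close> make each of the \<open>k\<close> squares in the form at most \<open>1\<close>.
\<close>

lemma bohr_set0_subset:
  assumes "N \<ge> 1" "k \<ge> 2" "\<And>i. i \<in> {1..k-1} \<Longrightarrow> 0 < \<delta> i"
  shows "bohr_set0 k \<alpha> N \<delta> \<subseteq> (\<lambda>x. x 0) ` {x \<in> zvec.lattice (bohr_system \<alpha> N \<delta> [1..<k]).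
           zvec.form (bohr_system \<alpha> N \<delta> [1..<k]) x \<le> real k}"
proof
  fix n assume n: "n \<in> bohr_set0 k \<alpha> N \<delta>"
  define x where "x i = (if i = 0 then n else if i < k then round (of_int n * \<alpha> i) else 0)" for i
  have set: "set [1..<k] = {1..k-1}" using assms(2) by auto
  have "x \<in> zvec.lattice (bohr_system \<alpha> N \<delta> [1..<k])"
    by (rule lattice_bohr_system) (use assms(2) in \<open>auto simp: x_def\<close>)
  moreover have "zvec.form (bohr_system \<alpha> N \<delta> [1..<k]) x \<le> real k"
  proof -
    have "((of_int (x i) - of_int (x 0) * \<alpha> i) / \<delta> i)\<^sup>2 \<le> 1" if i: "i \<in> {1..k-1}" for i
    proof -
      have "\<bar>of_int n * \<alpha> i - of_int (round (of_int n * \<alpha> i))\<bar> \<le> \<delta> i"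
        using n i unfolding bohr_set0_def dist_nearest_int_def by blast
      moreover have "x i = round (of_int n * \<alpha> i)" "x 0 = n" using i by (auto simp: x_def)
      ultimately have "\<bar>(of_int (x i) - of_int (x 0) * \<alpha> i) / \<delta> i\<bar> \<le> 1"
        using assms(3)[OF i] by (simp add: abs_minus_commute)
      then show ?thesis by (simp add: abs_square_le_1)
    qed
    then have "(\<Sum>i=1..k-1. ((of_int (x i) - of_int (x 0) * \<alpha> i) / \<delta> i)\<^sup>2) \<le> (\<Sum>i=1..k-1. 1)"
      by (intro sum_mono) auto
    moreover have "\<bar>of_int (x 0) / real N\<bar> \<le> 1" using n assms(1)
      unfolding bohr_set0_def by (auto simp: x_def)
    then have "(of_int (x 0) / real N)\<^sup>2 \<le> 1" by (simp add: abs_square_le_1)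
    ultimately show ?thesis unfolding form_bohr_system[OF distinct_upt] set using assms(2) by simp
  qed
  moreover have "n = x 0" by (simp add: x_def)
  ultimately show "n \<in> (\<lambda>x. x 0) ` {x \<in> zvec.lattice (bohr_system \<alpha> N \<delta> [1..<k]).
           zvec.form (bohr_system \<alpha> N \<delta> [1..<k]) x \<le> real k}" by blast
qed

section \<open>Covering Bohr sets by progressions\<close>

theorem lemma3p2:
  fixes k :: nat and \<alpha> :: "nat \<Rightarrow> real"
  assumes "k \<ge> 2"
    and "if k = 2 then mult_exponent k \<alpha> < \<infinity>
         else mult_exponent k \<alpha> < ereal ((real k - 1) / (real k - 2))"
  shows "\<exists>\<epsilon>\<^sub>0::real. \<epsilon>\<^sub>0 > 0 \<and> (\<forall>\<epsilon>::real. 0 < \<epsilon> \<and> \<epsilon> \<le> \<epsilon>\<^sub>0 \<longrightarrow>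
    (let \<tau> = sqrt \<epsilon> in
     \<exists>(N\<^sub>0::nat) (C::real). N\<^sub>0 \<ge> 1 \<and> C > 0 \<and>
      (\<forall>(N::nat) (\<delta>::nat \<Rightarrow> real). N \<ge> N\<^sub>0 \<and>
         (\<forall>i\<in>{1..k-1}. real N powr (- \<tau>) \<le> \<delta> i \<and> \<delta> i \<le> 2) \<longrightarrow>
        (\<exists>(A::nat \<Rightarrow> nat) (L::nat \<Rightarrow> nat).
           (\<forall>i\<in>{1..k}. A i \<ge> 1 \<and> L i \<ge> 1) \<and>
           bohr_set0 k \<alpha> N \<delta> \<subseteq> gap k 0 A L \<and>
           real (card (gap k 0 A L)) \<le> C * (\<Prod>i=1..k-1. \<delta> i) * real N))))"
proof -
  obtain w where w: "w > 0" "w * (real k - 2) < real k - 1" "mult_exponent k \<alpha> < ereal w"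
    using admissible_exponent[OF assms] by blast
  obtain c where c: "c > 0"
    "\<And>n. n \<ge> 1 \<Longrightarrow> c * real n powr (- w) \<le> (\<Prod>i=1..k-1. dist_nearest_int (real n * \<alpha> i))"
    using mult_exponent_lower_bound[OF w(3)] by blast
  define \<kappa> where "\<kappa> = (real k - 1 + w - w * (real k - 1)) / (real k - 1 + w)"
  have \<kappa>: "0 < \<kappa>" unfolding \<kappa>_def using w assms(1) by (intro divide_pos_pos) (auto simp: algebra_simps)
  \<comment> \<open>The largest \<open>\<tau>\<close> for which the product of the \<open>\<delta> i\<close> costs at most half of the exponent \<open>\<kappa>\<close>.\<close>
  define \<tau>\<^sub>0 where "\<tau>\<^sub>0 = \<kappa> / (2 * (real k - 1))"
  have \<tau>\<^sub>0: "\<tau>\<^sub>0 > 0" using \<kappa> assms(1) by (simp add: \<tau>\<^sub>0_def)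
  obtain C where C: "C > 0" and cover: "\<And>S h. zvec.triangular S \<Longrightarrow> length S = k \<Longrightarrow> zvec.linear_form (\<lambda>x. real_of_int (h x)) \<Longrightarrow>
       (\<And>x. x \<in> zvec.lattice S \<Longrightarrow> x \<noteq> 0 \<Longrightarrow> 2 ^ (k * k) * zvec.disc S \<le> zvec.form S x ^ (k - 1)) \<Longrightarrow>
     \<exists>A L. (\<forall>i\<in>{1..k}. A i \<ge> 1 \<and> L i \<ge> 1) \<and>
        h ` {x \<in> zvec.lattice S. zvec.form S x \<le> real k} \<subseteq> gap k 0 A L \<and>
        real (card (gap k 0 A L)) \<le> C / sqrt (zvec.disc S)"
    using zvec.progression_cover[of "real k" k] assms(1) by (auto simp: Ball_def)
  have main: "\<exists>N\<^sub>0 C. N\<^sub>0 \<ge> 1 \<and> C > 0 \<and>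
      (\<forall>N \<delta>. N \<ge> N\<^sub>0 \<and> (\<forall>i\<in>{1..k-1}. real N powr (- \<tau>) \<le> \<delta> i \<and> \<delta> i \<le> 2) \<longrightarrow>
        (\<exists>A L. (\<forall>i\<in>{1..k}. A i \<ge> 1 \<and> L i \<ge> 1) \<and> bohr_set0 k \<alpha> N \<delta> \<subseteq> gap k 0 A L \<and>
           real (card (gap k 0 A L)) \<le> C * (\<Prod>i=1..k-1. \<delta> i) * real N))"
    if "\<tau> \<le> \<tau>\<^sub>0" for \<tau>
  proof -
    have "(real k - 1) * \<tau> \<le> (real k - 1) * \<tau>\<^sub>0" using that assms(1) by (intro mult_left_mono) auto
    also have "\<dots> = \<kappa> / 2" using assms(1) by (simp add: \<tau>\<^sub>0_def field_simps)
    finally have \<tau>: "(real k - 1) * \<tau> \<le> \<kappa> / 2" .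
    obtain c' where c': "c' > 0" and minimum: "\<And>N \<delta> x. N \<ge> 1 \<Longrightarrow> \<forall>i\<in>{1..k-1}. real N powr (- \<tau>) \<le> \<delta> i \<and> \<delta> i \<le> 2 \<Longrightarrow>
     0 < zvec.form (bohr_system \<alpha> N \<delta> [1..<k]) x \<Longrightarrow>
     c' * real N powr (\<kappa> / 2) \<le> sqrt (zvec.form (bohr_system \<alpha> N \<delta> [1..<k]) x) ^ (k - 1) * (real N * (\<Prod>i=1..k-1. \<delta> i))"
      using bohr_lattice_minimum[OF assms(1) w(1,2) c \<tau>[unfolded \<kappa>_def]] unfolding \<kappa>_def by blast
    \<comment> \<open>Beyond \<open>N1\<close> the lattice minimum outweighs the loss of a factor depending on \<open>k\<close> in the reduction.\<close>
    define N1 where "N1 = nat \<lceil>(2 ^ (k * k) / c') powr (2 / \<kappa>)\<rceil>"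
    have N1: "2 ^ (k * k) \<le> c' * real N powr (\<kappa> / 2)" if "N \<ge> N1" for N
    proof -
      have "(2 ^ (k * k) / c') powr (2 / \<kappa>) \<le> real N" using that unfolding N1_def by linarith
      then have "((2 ^ (k * k) / c') powr (2 / \<kappa>)) powr (\<kappa> / 2) \<le> real N powr (\<kappa> / 2)"
        using \<kappa> by (intro powr_mono2) auto
      then have "2 ^ (k * k) / c' \<le> real N powr (\<kappa> / 2)" using \<kappa> c' by (simp add: powr_powr)
      then show ?thesis using c' by (simp add: field_simps)
    qed
    have "\<exists>A L. (\<forall>i\<in>{1..k}. A i \<ge> 1 \<and> L i \<ge> 1) \<and> bohr_set0 k \<alpha> N \<delta> \<subseteq> gap k 0 A L \<and>
           real (card (gap k 0 A L)) \<le> C * (\<Prod>i=1..k-1. \<delta> i) * real N"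
      if "N \<ge> max 1 N1" and \<delta>: "\<forall>i\<in>{1..k-1}. real N powr (- \<tau>) \<le> \<delta> i \<and> \<delta> i \<le> 2" for N \<delta>
    proof -
      have N: "N \<ge> 1" "N \<ge> N1" using that(1) by auto
      define S where "S = bohr_system \<alpha> N \<delta> [1..<k]"
      define V where "V = real N * (\<Prod>i=1..k-1. \<delta> i)"
      have set: "set [1..<k] = {1..k-1}" using assms(1) by auto
      have \<delta>0: "0 < \<delta> i" if "i \<in> {1..k-1}" for i
      proof -
        have "0 < real N powr (- \<tau>)" using N(1) by simp
        then show ?thesis using \<delta>[rule_format, OF that] by linarith
      qed
      have V: "V > 0" unfolding V_def using N \<delta>0 by (intro mult_pos_pos prod_pos) auto
      have tri: "zvec.triangular S" unfolding S_def using N \<delta>0 by (intro triangular_bohr_system) auto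
      have disc: "zvec.disc S = 1 / V\<^sup>2" unfolding S_def V_def disc_bohr_system[OF distinct_upt] set ..
      have len: "length S = k" using assms(1) by (simp add: S_def length_bohr_system)
      have short: "2 ^ (k * k) * zvec.disc S \<le> zvec.form S x ^ (k - 1)" if x: "x \<in> zvec.lattice S" "x \<noteq> 0" for x
      proof -
        have pos: "0 < zvec.form S x"
          using zvec.form_positive_minimum[OF tri] x by force
        have "2 ^ (k * k) \<le> sqrt (zvec.form S x) ^ (k - 1) * V"
          using N1[OF N(2)] minimum[OF N(1) \<delta>, of x] pos by (simp add: S_def V_def)
        then have "(2 ^ (k * k))\<^sup>2 \<le> (sqrt (zvec.form S x) ^ (k - 1) * V)\<^sup>2" by (intro power_mono) auto
        also have "\<dots> = (sqrt (zvec.form S x))\<^sup>2 ^ (k - 1) * V\<^sup>2"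
          by (simp only: power_mult_distrib power_mult[symmetric] mult.commute)
        also have "\<dots> = zvec.form S x ^ (k - 1) * V\<^sup>2" using pos by simp
        finally have "(2::real) ^ (k * k) \<le> zvec.form S x ^ (k - 1) * V\<^sup>2"
          by (rule order_trans[rotated]) (simp add: self_le_power)
        then show ?thesis using V by (simp add: disc field_simps)
      qed
      obtain A L where AL: "\<forall>i\<in>{1..k}. A i \<ge> 1 \<and> L i \<ge> 1"
          "(\<lambda>x. x 0) ` {x \<in> zvec.lattice S. zvec.form S x \<le> real k} \<subseteq> gap k 0 A L"
          "real (card (gap k 0 A L)) \<le> C / sqrt (zvec.disc S)"
        using cover[OF tri len, of "\<lambda>x. x 0"] short by (auto simp: zvec.linear_form_def)
      have "bohr_set0 k \<alpha> N \<delta> \<subseteq> gap k 0 A L"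
        using bohr_set0_subset[OF N(1) assms(1), of \<delta> \<alpha>] \<delta>0 AL(2) unfolding S_def by (meson order_trans)
      moreover have "C / sqrt (zvec.disc S) = C * (\<Prod>i=1..k-1. \<delta> i) * real N"
        using V by (simp add: disc real_sqrt_divide) (simp add: V_def)
      ultimately show ?thesis using AL(1,3) by (intro exI[of _ A] exI[of _ L]) simp
    qed
    then show ?thesis using C by (intro exI[of _ "max 1 N1"] exI[of _ C]) auto
  qed
  show ?thesis
  proof (intro exI[of _ "\<tau>\<^sub>0\<^sup>2"] conjI allI impI)
    show "0 < \<tau>\<^sub>0\<^sup>2" using \<tau>\<^sub>0 by simp
    fix \<epsilon> :: real
    assume "0 < \<epsilon> \<and> \<epsilon> \<le> \<tau>\<^sub>0\<^sup>2"
    then have "sqrt \<epsilon> \<le> \<tau>\<^sub>0" using \<tau>\<^sub>0 by (simp add: real_le_lsqrt)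
    then show "let \<tau> = sqrt \<epsilon> in
     \<exists>(N\<^sub>0::nat) (C::real). N\<^sub>0 \<ge> 1 \<and> C > 0 \<and>
      (\<forall>(N::nat) (\<delta>::nat \<Rightarrow> real). N \<ge> N\<^sub>0 \<and>
         (\<forall>i\<in>{1..k-1}. real N powr (- \<tau>) \<le> \<delta> i \<and> \<delta> i \<le> 2) \<longrightarrow>
        (\<exists>(A::nat \<Rightarrow> nat) (L::nat \<Rightarrow> nat).
           (\<forall>i\<in>{1..k}. A i \<ge> 1 \<and> L i \<ge> 1) \<and>
           bohr_set0 k \<alpha> N \<delta> \<subseteq> gap k 0 A L \<and>
           real (card (gap k 0 A L)) \<le> C * (\<Prod>i=1..k-1. \<delta> i) * real N))"
      unfolding Let_def by (rule main)
  qed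
qed

end
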